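(* For every integer $k\ge 2$ there exists $n_0=n_0(k)$ such that for all $n\ge n_0$, \[ F(n,k)\le f(n,k)\le k\cdot 2^{\,n/2+2\log n\,\sqrt{n}}. \]
   Context: $B_n$ denotes the Boolean lattice, i.e. the power set $2^{[n]}$ of $[n]=\{1,\dots,n\}$ ordered by inclusion. An antichain of size $k$ is a family of $k$ pairwise incomparable sets. For a (partial) coloring $c$ of $B_n$, a family is rainbow if its members receive pairwise distinct colors (in a partial coloring, all members must be colored). $F(n,k)$ is the maximum $m$ such that there is a coloring $c:B_n\to[k]$ of all of $B_n$ with no rainbow antichain of size $k$ and with every color class $c^{-1}(\{i\})$, $i\in[k]$, of size at least $m$. $f(n,k)$ is defined identically except that $c$ may be a partial coloring (some sets left uncolored). Here $\log$ denotes the logarithm to base $2$. *)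

theory Defs
  imports Complex_Main
begin

definition boolean_lattice :: "nat \<Rightarrow> nat set set" where
  "boolean_lattice n = Pow {1..n}"

definition antichain :: "'a set set \<Rightarrow> bool" where
  "antichain A \<longleftrightarrow> pairwise (\<lambda>X Y. \<not> X \<subseteq> Y \<and> \<not> Y \<subseteq> X) A"

text \<open>A partial coloring is a map whose domain is the family of colored sets;
  a coloring of all of \<open>B\<^sub>n\<close> is a map with domain exactly \<open>B\<^sub>n\<close>.\<close>

definition partial_coloring :: "nat \<Rightarrow> nat \<Rightarrow> (nat set \<rightharpoonup> nat) \<Rightarrow> bool" where
  "partial_coloring n k c \<longleftrightarrow> dom c \<subseteq> boolean_lattice n \<and> ran c \<subseteq> {1..k}"

definition full_coloring :: "nat \<Rightarrow> nat \<Rightarrow> (nat set \<rightharpoonup> nat) \<Rightarrow> bool" where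
  "full_coloring n k c \<longleftrightarrow> dom c = boolean_lattice n \<and> ran c \<subseteq> {1..k}"

definition color_class :: "('a \<rightharpoonup> nat) \<Rightarrow> nat \<Rightarrow> 'a set" where
  "color_class c i = {X. c X = Some i}"

definition rainbow :: "('a \<rightharpoonup> nat) \<Rightarrow> 'a set \<Rightarrow> bool" where
  "rainbow c A \<longleftrightarrow> A \<subseteq> dom c \<and> inj_on c A"

definition has_rainbow_antichain :: "nat \<Rightarrow> nat \<Rightarrow> (nat set \<rightharpoonup> nat) \<Rightarrow> bool" where
  "has_rainbow_antichain n k c \<longleftrightarrow>
     (\<exists>A. A \<subseteq> boolean_lattice n \<and> antichain A \<and> finite A \<and> card A = k \<and> rainbow c A)"

definition F_admissible :: "nat \<Rightarrow> nat \<Rightarrow> nat set" where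
  "F_admissible n k = {m. \<exists>c. full_coloring n k c \<and> \<not> has_rainbow_antichain n k c \<and>
     (\<forall>i\<in>{1..k}. m \<le> card (color_class c i))}"

definition f_admissible :: "nat \<Rightarrow> nat \<Rightarrow> nat set" where
  "f_admissible n k = {m. \<exists>c. partial_coloring n k c \<and> \<not> has_rainbow_antichain n k c \<and>
     (\<forall>i\<in>{1..k}. m \<le> card (color_class c i))}"

definition F_max :: "nat \<Rightarrow> nat \<Rightarrow> nat" where
  "F_max n k = Max (F_admissible n k)"

definition f_max :: "nat \<Rightarrow> nat \<Rightarrow> nat" where
  "f_max n k = Max (f_admissible n k)"

text \<open>For \<open>k \<ge> 2\<close> the sets of admissible \<open>m\<close> are finite and nonempty, so both maxima exist.\<close>

lemma full_imp_partial: "full_coloring n k c \<Longrightarrow> partial_coloring n k c"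
  by (auto simp: full_coloring_def partial_coloring_def)

lemma F_admissible_subset: "F_admissible n k \<subseteq> f_admissible n k"
  using full_imp_partial by (fastforce simp: F_admissible_def f_admissible_def)

lemma finite_f_admissible:
  assumes "k \<ge> 2"
  shows "finite (f_admissible n k)"
proof (rule finite_subset)
  show "f_admissible n k \<subseteq> {..2 ^ n}"
  proof
    fix m assume "m \<in> f_admissible n k"
    then obtain c where c: "partial_coloring n k c" "\<forall>i\<in>{1..k}. m \<le> card (color_class c i)"
      by (auto simp: f_admissible_def)
    have "color_class c 1 \<subseteq> Pow {1..n}"
      using c(1) by (auto simp: color_class_def partial_coloring_def boolean_lattice_def)
    then have "card (color_class c 1) \<le> card (Pow {1..n})"
      by (intro card_mono) auto
    with c(2) assms show "m \<in> {..2 ^ n}"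
      by (force simp: card_Pow)
  qed
qed simp

lemma zero_in_F_admissible:
  assumes "k \<ge> 2"
  shows "0 \<in> F_admissible n k"
proof -
  define c where "c = (\<lambda>X. if X \<in> boolean_lattice n then Some (1::nat) else None)"
  have "full_coloring n k c"
    using assms by (auto simp: full_coloring_def c_def ran_def split: if_splits)
  moreover have "\<not> has_rainbow_antichain n k c"
  proof
    assume "has_rainbow_antichain n k c"
    then obtain A where A: "A \<subseteq> boolean_lattice n" "card A = k" "inj_on c A"
      by (auto simp: has_rainbow_antichain_def rainbow_def)
    from A(1) have "c ` A \<subseteq> {Some 1}" by (auto simp: c_def)
    then have "card (c ` A) \<le> card {Some (1::nat)}" by (rule card_mono[rotated]) simp
    with A assms show False by (simp add: card_image)
  qed
  ultimately show ?thesis by (auto simp: F_admissible_def)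
qed

lemma F_max_in_F_admissible:
  assumes "k \<ge> 2"
  shows "F_max n k \<in> F_admissible n k"
  unfolding F_max_def
proof (rule Max_in)
  show "finite (F_admissible n k)"
    using finite_subset[OF F_admissible_subset finite_f_admissible[OF assms]] .
  show "F_admissible n k \<noteq> {}"
    using zero_in_F_admissible[OF assms] by blast
qed

lemma f_max_in_f_admissible:
  assumes "k \<ge> 2"
  shows "f_max n k \<in> f_admissible n k"
  unfolding f_max_def
proof (rule Max_in)
  show "finite (f_admissible n k)"
    using finite_f_admissible[OF assms] .
  show "f_admissible n k \<noteq> {}"
    using zero_in_F_admissible[OF assms] F_admissible_subset by blast
qed

end

theory Submission
  imports Defs
begin

text \<open>Suppose all colour classes are large, and keep from each class its sets of size at most
  \<open>n div 2\<close> or the remaining ones, whichever are more. If \<open>L\<close> is a low and \<open>H\<close> a high class, then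
  the points lying in a fraction \<open>1/(2n)\<close> of the members of \<open>L\<close> and the points missed by a fraction
  \<open>1/(2n)\<close> of the members of \<open>H\<close> are together more than \<open>n\<close> in number, so some \<open>x\<close> has both
  properties; restricting to the sets \<open>a \<in> L\<close> with \<open>x \<in> a\<close> and \<open>b \<in> H\<close> with \<open>x \<notin> b\<close> makes the two
  classes cross-incomparable. After at most \<open>k\<^sup>2\<close> such restrictions the low classes no
  longer interact with the high ones. Among the low classes, a largest set is comparable to at
  most \<open>2 ^ (n div 2)\<close> others, so a rainbow antichain is found greedily; the high classes
  are handled by taking complements. This loses only a factor polynomial in \<open>n\<close>.\<close>

section \<open>Frequent points and separating points\<close>

text \<open>A member of \<open>L\<close> either consists of frequent points only or contains an
  infrequent one. The latter kind number at most \<open>card V * t\<close>, half of the assumed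
  size, so the power set of the frequent points must account for the other half.\<close>

lemma many_frequent_points:
  fixes L :: "'a set set"
  assumes "finite V" "L \<subseteq> Pow V" "2 * card V * t \<le> card L"
  shows "card V * t \<le> 2 ^ card {x \<in> V. t \<le> card {a \<in> L. x \<in> a}}"
proof -
  define X where "X = {x \<in> V. t \<le> card {a \<in> L. x \<in> a}}"
  have finL: "finite L" using assms by (meson finite_Pow_iff finite_subset)
  have finX: "finite X" using assms(1) by (simp add: X_def)
  have "L \<subseteq> Pow X \<union> (\<Union>x\<in>V - X. {a \<in> L. x \<in> a})" using assms(2) by blast
  then have "card L \<le> card (Pow X \<union> (\<Union>x\<in>V - X. {a \<in> L. x \<in> a}))"
    using finX finL assms(1) by (intro card_mono) auto
  also have "\<dots> \<le> card (Pow X) + card (\<Union>x\<in>V - X. {a \<in> L. x \<in> a})" by (rule card_Un_le)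
  also have "card (\<Union>x\<in>V - X. {a \<in> L. x \<in> a}) \<le> (\<Sum>x\<in>V - X. card {a \<in> L. x \<in> a})"
    using assms(1) by (intro card_UN_le) simp
  also have "\<dots> \<le> (\<Sum>x\<in>V - X. t)"
    by (rule sum_mono) (auto simp: X_def)
  also have "\<dots> \<le> card V * t"
    using assms(1) by (simp add: card_mono)
  finally have "card L \<le> 2 ^ card X + card V * t" using finX by (simp add: card_Pow)
  with assms(3) show ?thesis by (simp add: X_def)
qed

lemma card_complements:
  assumes "H \<subseteq> Pow V"
  shows "card ((\<lambda>b. V - b) ` H) = card H"
  using assms by (intro card_image inj_onI) blast

text \<open>The count of frequent points is applied to \<open>L\<close> and to the complements of
  the members of \<open>H\<close>. Both resulting point sets satisfy
  \<open>t \<le> 2 ^ card X\<close>, so \<open>2 ^ card V < t * t\<close> makes them too large to be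
  disjoint inside \<open>V\<close>.\<close>

lemma separating_point:
  fixes L H :: "'a set set"
  assumes V: "finite V" "V \<noteq> {}" and sub: "L \<subseteq> Pow V" "H \<subseteq> Pow V"
    and large: "2 * card V * t \<le> card L" "2 * card V * t \<le> card H" and t: "2 ^ card V < t * t"
  shows "\<exists>x. t \<le> card {a \<in> L. x \<in> a} \<and> t \<le> card {b \<in> H. x \<notin> b}"
proof -
  define X where "X = {x \<in> V. t \<le> card {a \<in> L. x \<in> a}}"
  define Y where "Y = {x \<in> V. t \<le> card {b \<in> H. x \<notin> b}}"
  have fin: "finite X" "finite Y" "X \<union> Y \<subseteq> V" using V(1) by (auto simp: X_def Y_def)
  have X: "card V * t \<le> 2 ^ card X"
    unfolding X_def using V(1) sub(1) large(1) by (rule many_frequent_points)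
  have "card {a \<in> (\<lambda>b. V - b) ` H. x \<in> a} = card {b \<in> H. x \<notin> b}" if "x \<in> V" for x
  proof -
    have "{a \<in> (\<lambda>b. V - b) ` H. x \<in> a} = (\<lambda>b. V - b) ` {b \<in> H. x \<notin> b}" using that by blast
    moreover have "{b \<in> H. x \<notin> b} \<subseteq> Pow V" using sub(2) by blast
    ultimately show ?thesis by (simp add: card_complements)
  qed
  then have "{x \<in> V. t \<le> card {a \<in> (\<lambda>b. V - b) ` H. x \<in> a}} = Y"
    by (auto simp: Y_def)
  moreover have "card V * t \<le> 2 ^ card {x \<in> V. t \<le> card {a \<in> (\<lambda>b. V - b) ` H. x \<in> a}}"
    using V(1) large(2) by (intro many_frequent_points) (auto simp: card_complements[OF sub(2)])
  ultimately have Y: "card V * t \<le> 2 ^ card Y" by simp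
  have "1 \<le> card V" using V by (simp add: Suc_le_eq card_gt_0_iff)
  then have "t \<le> card V * t" by simp
  with X Y have "t \<le> 2 ^ card X" "t \<le> 2 ^ card Y" by linarith+
  then have "t * t \<le> 2 ^ card X * 2 ^ card Y" by (intro mult_mono) auto
  with t have "(2::nat) ^ card V < 2 ^ (card X + card Y)" by (simp add: power_add)
  then have "card V < card X + card Y" by simp
  moreover have "card (X \<union> Y) \<le> card V" using V(1) fin(3) by (rule card_mono)
  ultimately have "X \<inter> Y \<noteq> {}" using card_Un_disjoint[OF fin(1,2)] by auto
  then show ?thesis by (auto simp: X_def Y_def)
qed

section \<open>Excluding containments between prescribed pairs of families\<close>

text \<open>One separating point is used per pair, each at the price of a factor
  \<open>2 * card V\<close>; pairs already treated stay good because the property passes to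
  subfamilies. Only one direction of containment is excluded for each ordered pair.\<close>

lemma cross_incomparable_subfamilies:
  fixes G :: "'i \<Rightarrow> 'a set set"
  assumes "finite P" "finite V" "V \<noteq> {}" "\<And>i j. (i, j) \<in> P \<Longrightarrow> i \<in> I \<and> j \<in> I \<and> i \<noteq> j"
    and "\<And>i. i \<in> I \<Longrightarrow> G i \<subseteq> Pow V" "\<And>i. i \<in> I \<Longrightarrow> (2 * card V) ^ card P * t \<le> card (G i)"
    and "2 ^ card V < t * t"
  shows "\<exists>G'. (\<forall>i\<in>I. G' i \<subseteq> G i \<and> t \<le> card (G' i)) \<and>
    (\<forall>i j. (i, j) \<in> P \<longrightarrow> (\<forall>a\<in>G' i. \<forall>b\<in>G' j. \<not> a \<subseteq> b))"
  using assms
proof (induction P arbitrary: t rule: finite_induct)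
  case empty
  then show ?case by auto
next
  case (insert p P)
  obtain i j where p: "p = (i, j)" by force
  \<comment> \<open>The induction hypothesis is used with this larger size: it is what the last
    separating point needs in order to leave \<open>t\<close> sets in both families of the pair
    \<open>p\<close>.\<close>
  define u where "u = 2 * card V * t"
  have ij: "i \<in> I" "j \<in> I" "i \<noteq> j" using insert.prems(3) p by auto
  have "1 \<le> card V" using insert.prems(1,2) by (simp add: Suc_le_eq card_gt_0_iff)
  then have tu: "t \<le> u" by (simp add: u_def)
  then have "t * t \<le> u * u" by (intro mult_mono) auto
  then have uu: "2 ^ card V < u * u" using insert.prems(6) by linarith
  have "(2 * card V) ^ card P * u \<le> card (G i)" if "i \<in> I" for i
    using insert.prems(5)[OF that] insert.hyps by (simp add: u_def mult_ac)
  then have "\<exists>G'. (\<forall>i\<in>I. G' i \<subseteq> G i \<and> u \<le> card (G' i)) \<and>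
      (\<forall>i j. (i, j) \<in> P \<longrightarrow> (\<forall>a\<in>G' i. \<forall>b\<in>G' j. \<not> a \<subseteq> b))"
    by (rule insert.IH[OF insert.prems(1,2,3) insert.prems(4) _ uu, rotated 2]) simp_all
  then obtain G' where G': "\<And>l. l \<in> I \<Longrightarrow> G' l \<subseteq> G l \<and> u \<le> card (G' l)"
    and cross: "\<And>l m a b. (l, m) \<in> P \<Longrightarrow> a \<in> G' l \<Longrightarrow> b \<in> G' m \<Longrightarrow> \<not> a \<subseteq> b"
    by metis
  have "G' i \<subseteq> Pow V" "G' j \<subseteq> Pow V" using G' insert.prems(4) ij by blast+
  then obtain x where x: "t \<le> card {a \<in> G' i. x \<in> a}" "t \<le> card {b \<in> G' j. x \<notin> b}"
    using separating_point[OF insert.prems(1,2) _ _ _ _ insert.prems(6)] G' ij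
    unfolding u_def by meson
  define G'' where "G'' = G'(i := {a \<in> G' i. x \<in> a}, j := {b \<in> G' j. x \<notin> b})"
  have sub: "G'' l \<subseteq> G' l" for l by (auto simp: G''_def)
  show ?case
  proof (intro exI[of _ G''] conjI ballI)
    fix l assume "l \<in> I"
    then show "G'' l \<subseteq> G l" using sub G' by blast
    show "t \<le> card (G'' l)"
      using x G'[OF \<open>l \<in> I\<close>] tu by (auto simp: G''_def)
  next
    show "\<forall>l m. (l, m) \<in> insert p P \<longrightarrow> (\<forall>a\<in>G'' l. \<forall>b\<in>G'' m. \<not> a \<subseteq> b)"
    proof (intro allI impI ballI)
      fix l m a b assume "(l, m) \<in> insert p P" and ab: "a \<in> G'' l" "b \<in> G'' m"
      then consider "l = i" "m = j" | "(l, m) \<in> P" by (auto simp: p)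
      then show "\<not> a \<subseteq> b"
      proof cases
        case 1
        then have "x \<in> a" "x \<notin> b" using ab ij by (auto simp: G''_def)
        then show ?thesis by blast
      next
        case 2
        then show ?thesis using cross ab sub by blast
      qed
    qed
  qed
qed

section \<open>Greedy choice among small sets and among large sets\<close>

text \<open>Induction on the number of families: choose a set \<open>b\<close> of maximum
  cardinality in the whole union, and delete its subsets from the other families. Each of them loses
  at most \<open>2 ^ r\<close> sets, exactly what one fewer family allows.\<close>

lemma greedy_antichain_low:
  fixes G :: "'i \<Rightarrow> 'a set set"
  assumes "finite I" "finite V" "\<And>i. i \<in> I \<Longrightarrow> G i \<subseteq> Pow V"
    and "\<And>i a. i \<in> I \<Longrightarrow> a \<in> G i \<Longrightarrow> card a \<le> r" "\<And>i. i \<in> I \<Longrightarrow> card I * 2 ^ r \<le> card (G i)"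
  shows "\<exists>g. (\<forall>i\<in>I. g i \<in> G i) \<and> (\<forall>i\<in>I. \<forall>j\<in>I. i \<noteq> j \<longrightarrow> \<not> g i \<subseteq> g j)"
  using assms
proof (induction "card I" arbitrary: I G)
  case 0
  then show ?case by auto
next
  case (Suc s)
  define U where "U = (\<Union>i\<in>I. G i)"
  have finU: "finite U" unfolding U_def using Suc.prems(1,2,3)
    by (meson finite_Pow_iff finite_UN_I finite_subset)
  obtain i0 where "i0 \<in> I" using Suc.hyps(2) by (metis card.empty equals0I nat.distinct(1))
  have "1 \<le> card I * 2 ^ r" using Suc.hyps(2) by (metis One_nat_def Suc_le_eq nat_0_less_mult_iff zero_less_Suc zero_less_numeral zero_less_power)
  also have "\<dots> \<le> card (G i0)" using Suc.prems(5) \<open>i0 \<in> I\<close> .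
  finally have "G i0 \<noteq> {}" by auto
  then have "U \<noteq> {}" using \<open>i0 \<in> I\<close> by (auto simp: U_def)
  then have "Max (card ` U) \<in> card ` U" using finU by (intro Max_in) auto
  then obtain b where b: "b \<in> U" "card b = Max (card ` U)" by auto
  then have bmax: "card a \<le> card b" if "a \<in> U" for a
    using that finU by simp
  obtain i where i: "i \<in> I" "b \<in> G i" using b by (auto simp: U_def)
  have finb: "finite b" using Suc.prems(2,3) i by (meson Pow_iff finite_subset subsetD)
  define G' where "G' = (\<lambda>j. G j - Pow b)"
  have "card (I - {i}) * 2 ^ r \<le> card (G' j)" if "j \<in> I - {i}" for j
  proof -
    have "card I * 2 ^ r \<le> card (G j)" using Suc.prems(5) that by blast
    moreover have "card (G j) - card (Pow b) \<le> card (G' j)"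
      unfolding G'_def using finb by (intro diff_card_le_card_Diff) simp
    moreover have "card (Pow b) \<le> 2 ^ r" using Suc.prems(4)[OF i] finb by (simp add: card_Pow)
    moreover have "card I * 2 ^ r = card (I - {i}) * 2 ^ r + 2 ^ r"
      using card.remove[OF Suc.prems(1) i(1)] by simp
    ultimately show ?thesis by linarith
  qed
  moreover have "s = card (I - {i})" using Suc.hyps(2) Suc.prems(1) i by simp
  moreover have "G' j \<subseteq> Pow V" "\<And>a. a \<in> G' j \<Longrightarrow> card a \<le> r" if "j \<in> I - {i}" for j
    using Suc.prems(3,4) that by (auto simp: G'_def)
  ultimately have "\<exists>g. (\<forall>j\<in>I - {i}. g j \<in> G' j) \<and>
      (\<forall>j\<in>I - {i}. \<forall>l\<in>I - {i}. j \<noteq> l \<longrightarrow> \<not> g j \<subseteq> g l)"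
    using Suc.prems(1,2) by (intro Suc.hyps(1)) simp_all
  then obtain g where g: "\<forall>j\<in>I - {i}. g j \<in> G' j"
    "\<forall>j\<in>I - {i}. \<forall>l\<in>I - {i}. j \<noteq> l \<longrightarrow> \<not> g j \<subseteq> g l" by blast
  \<comment> \<open>The first half holds by the deletion. For the second, a superset of
    \<open>b\<close> of no larger cardinality would equal \<open>b\<close>, which was deleted
    too.\<close>
  have "\<not> g j \<subseteq> b \<and> \<not> b \<subseteq> g j" if "j \<in> I - {i}" for j
  proof -
    have gj: "g j \<in> G j" "\<not> g j \<subseteq> b" using g that by (auto simp: G'_def)
    have "card (g j) \<le> card b" using bmax gj(1) that by (auto simp: U_def)
    moreover have "g j \<subseteq> V" using Suc.prems(3) gj(1) that by blast
    then have "finite (g j)" using Suc.prems(2) finite_subset by blast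
    ultimately show ?thesis using gj(2) card_seteq[of "g j" b] by auto
  qed
  then show ?case using g i by (intro exI[of _ "g(i := b)"]) (auto simp: G'_def)
qed

text \<open>Complementation in \<open>V\<close> reverses inclusion and turns sets missing at most
  \<open>r\<close> points into sets of size at most \<open>r\<close>, so the low case
  applies.\<close>

lemma greedy_antichain_high:
  fixes G :: "'i \<Rightarrow> 'a set set"
  assumes "finite I" "finite V" "\<And>i. i \<in> I \<Longrightarrow> G i \<subseteq> Pow V"
    and "\<And>i a. i \<in> I \<Longrightarrow> a \<in> G i \<Longrightarrow> card V - card a \<le> r" "\<And>i. i \<in> I \<Longrightarrow> card I * 2 ^ r \<le> card (G i)"
  shows "\<exists>g. (\<forall>i\<in>I. g i \<in> G i) \<and> (\<forall>i\<in>I. \<forall>j\<in>I. i \<noteq> j \<longrightarrow> \<not> g i \<subseteq> g j)"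
proof -
  have "\<exists>g. (\<forall>i\<in>I. g i \<in> (\<lambda>b. V - b) ` G i) \<and> (\<forall>i\<in>I. \<forall>j\<in>I. i \<noteq> j \<longrightarrow> \<not> g i \<subseteq> g j)"
  proof (rule greedy_antichain_low[OF assms(1,2)])
    fix i a assume "i \<in> I" "a \<in> (\<lambda>b. V - b) ` G i"
    then obtain b where b: "b \<in> G i" "a = V - b" by blast
    then have "b \<subseteq> V" using assms(3) \<open>i \<in> I\<close> by blast
    then show "card a \<le> r"
      using assms(2) assms(4)[OF \<open>i \<in> I\<close> b(1)] b(2) by (simp add: card_Diff_subset finite_subset)
  next
    fix i assume "i \<in> I"
    then show "card I * 2 ^ r \<le> card ((\<lambda>b. V - b) ` G i)"
      using card_complements[OF assms(3)] assms(5) by simp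
  qed blast
  then obtain g where g: "\<And>i. i \<in> I \<Longrightarrow> g i \<in> (\<lambda>b. V - b) ` G i"
    "\<And>i j. i \<in> I \<Longrightarrow> j \<in> I \<Longrightarrow> i \<noteq> j \<Longrightarrow> \<not> g i \<subseteq> g j" by metis
  show ?thesis
  proof (intro exI[of _ "\<lambda>i. V - g i"] conjI ballI impI)
    fix i assume i: "i \<in> I"
    then obtain b where "b \<in> G i" "g i = V - b" using g(1) by blast
    with assms(3)[OF i] show "V - g i \<in> G i" by (auto simp: double_diff)
  next
    fix i j assume "i \<in> I" "j \<in> I" "i \<noteq> j"
    then have "\<not> g j \<subseteq> g i" "g j \<subseteq> V" using g by blast+
    then show "\<not> V - g i \<subseteq> V - g j" by blast
  qed
qed

section \<open>Antichain transversals of large families\<close>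

text \<open>In the size bound, one factor 2 pays for keeping the larger of the low and high parts
  and another for \<open>t * t\<close> to exceed \<open>2 ^ card V\<close>. The power of
  \<open>2 * card V\<close> pays for the pairs in \<open>Lo \<times> Hi\<close>, and the last factor
  is the demand of the greedy choice.\<close>

lemma large_families_have_antichain_transversal:
  fixes G :: "'i \<Rightarrow> 'a set set"
  assumes I: "finite I" "I \<noteq> {}" and V: "finite V" "V \<noteq> {}"
    and sub: "\<And>i. i \<in> I \<Longrightarrow> G i \<subseteq> Pow V"
    and large: "\<And>i. i \<in> I \<Longrightarrow>
      4 * (2 * card V) ^ (card I)\<^sup>2 * (card I * 2 ^ (card V div 2)) \<le> card (G i)"
  shows "\<exists>g. (\<forall>i\<in>I. g i \<in> G i) \<and> (\<forall>i\<in>I. \<forall>j\<in>I. i \<noteq> j \<longrightarrow> \<not> g i \<subseteq> g j)"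
proof -
  define r where "r = card V div 2"
  define low where "low = (\<lambda>i. {a \<in> G i. card a \<le> r})"
  define high where "high = (\<lambda>i. {a \<in> G i. \<not> card a \<le> r})"
  define Lo where "Lo = {i \<in> I. card (high i) \<le> card (low i)}"
  define Hi where "Hi = I - Lo"
  define G1 where "G1 = (\<lambda>i. if i \<in> Lo then low i else high i)"
  define t where "t = 2 * (card I * 2 ^ r)"
  have cV: "1 \<le> card V" and cI: "1 \<le> card I"
    using I V by (simp_all add: Suc_le_eq card_gt_0_iff)
  have LoHi: "Lo \<subseteq> I" "Hi \<subseteq> I" "Lo \<inter> Hi = {}" "I = Lo \<union> Hi" by (auto simp: Lo_def Hi_def)
  then have fin: "finite Lo" "finite Hi" using I by (auto intro: finite_subset)
  have cardP: "card (Lo \<times> Hi) \<le> (card I)\<^sup>2"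
    using LoHi I by (simp add: card_cartesian_product power2_eq_square card_mono mult_mono)
  have G1_large: "(2 * card V) ^ card (Lo \<times> Hi) * t \<le> card (G1 i)" if i: "i \<in> I" for i
  proof -
    have "finite (G i)" using sub[OF i] V(1) by (meson finite_Pow_iff finite_subset)
    then have "card (low i) + card (high i) = card (low i \<union> high i)"
      by (intro card_Un_disjoint[symmetric]) (auto simp: low_def high_def)
    moreover have "low i \<union> high i = G i" by (auto simp: low_def high_def)
    ultimately have "card (G i) \<le> 2 * card (G1 i)" using i by (auto simp: G1_def Lo_def)
    then have "(2 * card V) ^ (card I)\<^sup>2 * t \<le> card (G1 i)"
      using large[OF i] by (simp add: t_def r_def)
    moreover have "(2 * card V) ^ card (Lo \<times> Hi) \<le> (2 * card V) ^ (card I)\<^sup>2"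
      using cardP cV by (intro power_increasing) auto
    then have "(2 * card V) ^ card (Lo \<times> Hi) * t \<le> (2 * card V) ^ (card I)\<^sup>2 * t" by simp
    ultimately show ?thesis by linarith
  qed
  have tt: "2 ^ card V < t * t"
  proof -
    \<comment> \<open>Rounding down in \<open>r\<close> gives \<open>card V \<le> 2 * r + 1\<close>;
      the extra factor 2 in \<open>t\<close> makes up for this.\<close>
    have "(2::nat) ^ card V < 2 ^ (2 * (r + 1))"
      by (rule power_strict_increasing) (auto simp: r_def)
    also have "\<dots> = 2 ^ (r + 1) * 2 ^ (r + 1)" by (simp only: power_add[symmetric] mult_2)
    also have "\<dots> \<le> t * t" using cI by (intro mult_mono) (auto simp: t_def)
    finally show ?thesis .
  qed
  have G1_sub: "G1 i \<subseteq> Pow V" if "i \<in> I" for i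
    using sub[OF that] by (auto simp: G1_def low_def high_def)
  have "\<exists>G2. (\<forall>i\<in>I. G2 i \<subseteq> G1 i \<and> t \<le> card (G2 i)) \<and>
      (\<forall>i j. (i, j) \<in> Lo \<times> Hi \<longrightarrow> (\<forall>a\<in>G2 i. \<forall>b\<in>G2 j. \<not> a \<subseteq> b))"
    by (rule cross_incomparable_subfamilies[OF _ V _ G1_sub G1_large tt])
      (use fin LoHi in auto)
  then obtain G2 where G2: "\<And>i. i \<in> I \<Longrightarrow> G2 i \<subseteq> G1 i" "\<And>i. i \<in> I \<Longrightarrow> t \<le> card (G2 i)"
    and cross: "\<And>i j a b. i \<in> Lo \<Longrightarrow> j \<in> Hi \<Longrightarrow> a \<in> G2 i \<Longrightarrow> b \<in> G2 j \<Longrightarrow> \<not> a \<subseteq> b"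
    by (metis mem_Sigma_iff)
  have G2_Pow: "G2 i \<subseteq> Pow V" if "i \<in> I" for i using G2(1) G1_sub that by blast
  have G2_G: "G2 i \<subseteq> G i" if "i \<in> I" for i
    using G2(1)[OF that] by (auto simp: G1_def low_def high_def split: if_splits)
  have lowD: "card a \<le> r" if "i \<in> Lo" "a \<in> G2 i" for i a
    using G2(1)[of i] that LoHi by (auto simp: G1_def low_def)
  have highD: "r < card a" if "i \<in> Hi" "a \<in> G2 i" for i a
    using G2(1)[of i] that by (auto simp: G1_def high_def Hi_def)
  have G2_large: "card J * 2 ^ r \<le> card (G2 i)" if "J \<subseteq> I" "i \<in> I" for i J
  proof -
    have "card J * 2 ^ r \<le> card I * 2 ^ r" using that I by (simp add: card_mono)
    also have "\<dots> \<le> t" by (simp add: t_def)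
    finally show ?thesis using G2(2)[OF that(2)] by linarith
  qed
  have "\<exists>g. (\<forall>i\<in>Lo. g i \<in> G2 i) \<and> (\<forall>i\<in>Lo. \<forall>j\<in>Lo. i \<noteq> j \<longrightarrow> \<not> g i \<subseteq> g j)"
    by (rule greedy_antichain_low[OF fin(1) V(1) G2_Pow lowD G2_large]) (use LoHi in auto)
  then obtain g where g: "\<And>i. i \<in> Lo \<Longrightarrow> g i \<in> G2 i"
    "\<And>i j. i \<in> Lo \<Longrightarrow> j \<in> Lo \<Longrightarrow> i \<noteq> j \<Longrightarrow> \<not> g i \<subseteq> g j" by metis
  \<comment> \<open>A high set has at least \<open>r + 1\<close> of the at most
    \<open>2 * r + 1\<close> points, so its complement is low.\<close>
  have highD': "card V - card a \<le> r" if "i \<in> Hi" "a \<in> G2 i" for i a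
    using highD[OF that] by (simp add: r_def)
  have "\<exists>h. (\<forall>i\<in>Hi. h i \<in> G2 i) \<and> (\<forall>i\<in>Hi. \<forall>j\<in>Hi. i \<noteq> j \<longrightarrow> \<not> h i \<subseteq> h j)"
    by (rule greedy_antichain_high[OF fin(2) V(1) G2_Pow highD' G2_large]) (use LoHi in auto)
  then obtain h where h: "\<And>i. i \<in> Hi \<Longrightarrow> h i \<in> G2 i"
    "\<And>i j. i \<in> Hi \<Longrightarrow> j \<in> Hi \<Longrightarrow> i \<noteq> j \<Longrightarrow> \<not> h i \<subseteq> h j" by metis
  define f where "f = (\<lambda>i. if i \<in> Lo then g i else h i)"
  have f: "f i \<in> G2 i" if "i \<in> I" for i using g h LoHi that by (auto simp: f_def)
  show ?thesis
  proof (intro exI[of _ f] conjI ballI impI)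
    fix i assume "i \<in> I"
    then show "f i \<in> G i" using f G2_G by blast
  next
    fix i j assume ij: "i \<in> I" "j \<in> I" "i \<noteq> j"
    consider "i \<in> Lo" "j \<in> Lo" | "i \<in> Lo" "j \<in> Hi" | "i \<in> Hi" "j \<in> Lo" | "i \<in> Hi" "j \<in> Hi"
      using ij LoHi by blast
    then show "\<not> f i \<subseteq> f j"
    proof cases
      case 1
      then show ?thesis using g ij by (simp add: f_def)
    next
      case 2
      then show ?thesis using cross f ij by blast
    next
      case 3
      \<comment> \<open>A high set cannot lie in a low one, being strictly larger. This is why only
        containments of low sets in high sets had to be removed.\<close>
      have "f j \<subseteq> V" using G2_Pow f ij by blast
      then have "finite (f j)" using V(1) finite_subset by blast
      moreover have "card (f j) < card (f i)" using lowD highD f 3 ij by (meson le_less_trans)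
      ultimately show ?thesis by (meson card_mono leD)
    next
      case 4
      then have "i \<notin> Lo" "j \<notin> Lo" using LoHi by auto
      then show ?thesis using h 4 ij by (simp add: f_def)
    qed
  qed
qed

section \<open>Application to colourings and the numerical bound\<close>

text \<open>A transversal of the colour classes is rainbow, and its \<open>k\<close> members are
  distinct since they have distinct colours; the absence of containments makes it an
  antichain.\<close>

lemma large_classes_have_rainbow_antichain:
  assumes k: "1 \<le> k" and n: "1 \<le> n" and c: "partial_coloring n k c"
    and large: "\<And>i. i \<in> {1..k} \<Longrightarrow>
      4 * (2 * n) ^ k\<^sup>2 * (k * 2 ^ (n div 2)) \<le> card (color_class c i)"
  shows "has_rainbow_antichain n k c"
proof -
  have sub: "color_class c i \<subseteq> Pow {1..n}" for i
    using c by (auto simp: color_class_def partial_coloring_def boolean_lattice_def)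
  have "\<exists>g. (\<forall>i\<in>{1..k}. g i \<in> color_class c i) \<and>
      (\<forall>i\<in>{1..k}. \<forall>j\<in>{1..k}. i \<noteq> j \<longrightarrow> \<not> g i \<subseteq> g j)"
    by (rule large_families_have_antichain_transversal[where V = "{1..n}"])
      (use k n sub large in auto)
  then obtain g where g: "\<And>i. i \<in> {1..k} \<Longrightarrow> g i \<in> color_class c i"
    "\<And>i j. i \<in> {1..k} \<Longrightarrow> j \<in> {1..k} \<Longrightarrow> i \<noteq> j \<Longrightarrow> \<not> g i \<subseteq> g j" by metis
  have cg: "c (g i) = Some i" if "i \<in> {1..k}" for i
    using g(1)[OF that] by (simp add: color_class_def)
  have inj: "inj_on g {1..k}" by (rule inj_onI) (metis cg option.inject)
  show ?thesis unfolding has_rainbow_antichain_def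
  proof (intro exI[of _ "g ` {1..k}"] conjI)
    show "g ` {1..k} \<subseteq> boolean_lattice n" unfolding boolean_lattice_def using g(1) sub by blast
    show "antichain (g ` {1..k})"
      unfolding antichain_def
    proof (rule pairwiseI)
      fix X Y assume "X \<in> g ` {1..k}" "Y \<in> g ` {1..k}" "X \<noteq> Y"
      then obtain i j where "i \<in> {1..k}" "j \<in> {1..k}" "i \<noteq> j" "X = g i" "Y = g j" by blast
      then show "\<not> X \<subseteq> Y \<and> \<not> Y \<subseteq> X" using g(2) by simp
    qed
    show "card (g ` {1..k}) = k" using card_image[OF inj] by simp
    show "rainbow c (g ` {1..k})" unfolding rainbow_def using cg by (auto simp: inj_on_def)
  qed simp
qed

text \<open>The lower bound on \<open>n\<close> says that \<open>k\<^sup>2 + 1\<close> is at most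
  \<open>sqrt n\<close>. Hence the polynomial factor, at most
  \<open>n ^ (2 * (k\<^sup>2 + 1))\<close>, is absorbed by \<open>n powr (2 * sqrt n)\<close>, which
  is the second part of the exponent in base 2.\<close>

lemma threshold_le:
  assumes k: "2 \<le> k" and n: "(k\<^sup>2 + 1)\<^sup>2 \<le> n"
  shows "real (4 * (2 * n) ^ k\<^sup>2 * (k * 2 ^ (n div 2))) \<le>
    real k * 2 powr (real n / 2 + 2 * log 2 (real n) * sqrt (real n))"
proof -
  have "2 \<le> k\<^sup>2 + 1" using k by (simp add: power2_eq_square)
  then have "2 \<le> (k\<^sup>2 + 1)\<^sup>2" using self_le_power[of "k\<^sup>2 + 1" 2] by linarith
  then have n2: "2 \<le> n" using n by linarith
  \<comment> \<open>For \<open>n\<close> at least 2, both the base \<open>2 * n\<close> and the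
    constant 4 are bounded by the square of \<open>n\<close>, which leaves a pure power of
    \<open>n\<close>.\<close>
  have "2 * n \<le> n\<^sup>2" using n2 by (simp add: power2_eq_square)
  then have "(2 * n) ^ k\<^sup>2 \<le> (n\<^sup>2) ^ k\<^sup>2" by (intro power_mono) auto
  moreover have "2 * 2 \<le> n * n" using n2 by (intro mult_mono) auto
  ultimately have "4 * (2 * n) ^ k\<^sup>2 \<le> n\<^sup>2 * (n\<^sup>2) ^ k\<^sup>2"
    by (intro mult_mono) (auto simp: power2_eq_square)
  also have "\<dots> = n ^ (2 * (k\<^sup>2 + 1))" by (simp add: power_mult power_add power2_eq_square)
  finally have "real (4 * (2 * n) ^ k\<^sup>2) \<le> real n ^ (2 * (k\<^sup>2 + 1))"
    by (metis of_nat_le_iff of_nat_power)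
  also have "\<dots> = real n powr (2 * (real k ^ 2 + 1))"
    using n2 powr_realpow[of "real n" "2 * (k\<^sup>2 + 1)"] by (simp add: add.commute)
  also have "\<dots> \<le> real n powr (2 * sqrt (real n))"
  proof (rule powr_mono)
    have "((real k)\<^sup>2 + 1)\<^sup>2 = real ((k\<^sup>2 + 1)\<^sup>2)" by simp
    also have "\<dots> \<le> real n" using n by (rule of_nat_mono)
    finally have "(real k)\<^sup>2 + 1 \<le> sqrt (real n)" by (rule real_le_rsqrt)
    then show "2 * ((real k)\<^sup>2 + 1) \<le> 2 * sqrt (real n)" by simp
  qed (use n2 in simp)
  also have "\<dots> = (2 powr log 2 (real n)) powr (2 * sqrt (real n))" using n2 by simp
  also have "\<dots> = 2 powr (2 * log 2 (real n) * sqrt (real n))"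
    by (simp add: powr_powr mult_ac)
  finally have A: "real (4 * (2 * n) ^ k\<^sup>2) \<le> 2 powr (2 * log 2 (real n) * sqrt (real n))" .
  have "real (2 ^ (n div 2)) = 2 powr real (n div 2)" by (simp add: powr_realpow)
  also have "\<dots> \<le> 2 powr (real n / 2)" by (intro powr_mono) auto
  finally have "real (4 * (2 * n) ^ k\<^sup>2) * (real k * real (2 ^ (n div 2)))
      \<le> 2 powr (2 * log 2 (real n) * sqrt (real n)) * (real k * 2 powr (real n / 2))"
    using A by (intro mult_mono) auto
  then show ?thesis by (simp add: powr_add mult_ac)
qed

theorem theorem2:
  fixes k :: nat
  assumes "k \<ge> 2"
  shows "\<exists>n\<^sub>0::nat. \<forall>n\<ge>n\<^sub>0. F_max n k \<le> f_max n k \<and>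
    real (f_max n k) \<le> real k * 2 powr (real n / 2 + 2 * log 2 (real n) * sqrt (real n))"
proof (intro exI[of _ "(k\<^sup>2 + 1)\<^sup>2"] allI impI conjI)
  fix n assume n: "(k\<^sup>2 + 1)\<^sup>2 \<le> n"
  \<comment> \<open>Full colourings are partial colourings, so the first maximum is admissible for
    the second.\<close>
  show "F_max n k \<le> f_max n k"
    unfolding f_max_def using F_max_in_F_admissible[OF assms] F_admissible_subset
    by (intro Max_ge finite_f_admissible[OF assms]) blast
  obtain c where c: "partial_coloring n k c" "\<not> has_rainbow_antichain n k c"
    "\<And>i. i \<in> {1..k} \<Longrightarrow> f_max n k \<le> card (color_class c i)"
    using f_max_in_f_admissible[OF assms, of n] by (auto simp: f_admissible_def)
  have "1 \<le> n" using n by (simp add: power2_eq_square)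
  \<comment> \<open>Otherwise every class of the extremal colouring \<open>c\<close> would reach the
    threshold and \<open>c\<close> would have a rainbow antichain.\<close>
  then have "f_max n k \<le> 4 * (2 * n) ^ k\<^sup>2 * (k * 2 ^ (n div 2))"
    using large_classes_have_rainbow_antichain[of k n c] c assms
    by (meson le_trans linear one_le_numeral)
  then have "real (f_max n k) \<le> real (4 * (2 * n) ^ k\<^sup>2 * (k * 2 ^ (n div 2)))"
    by (rule of_nat_mono)
  also have "\<dots> \<le> real k * 2 powr (real n / 2 + 2 * log 2 (real n) * sqrt (real n))"
    by (rule threshold_le[OF assms n])
  finally show "real (f_max n k) \<le>
    real k * 2 powr (real n / 2 + 2 * log 2 (real n) * sqrt (real n))" .
qed

end
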